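(* Let $p>3$ be a prime. Then the group $\mathbb{Z}_p^{2p+3}$ has an undirected Cayley graph which is not a CI-graph.
   Context: For a finite group $G$ and a subset $S\subseteq G$, the Cayley graph $Cay(G,S)$ is the graph with vertex set $G$ in which $g$ is joined to $h$ if and only if $gh^{-1}\in S$; it is undirected when $S=S^{-1}$ (for an abelian group written additively, $S=-S$). A Cayley graph $Cay(G,S)$ is a CI-graph if for every $T\subseteq G$, the graphs $Cay(G,S)$ and $Cay(G,T)$ are isomorphic if and only if there is a group automorphism $\sigma$ of $G$ with $\sigma(S)=T$. *)

theory Defs
  imports
    "HOL-Computational_Algebra.Primes"
    "HOL-Algebra.Product_Groups"
    "HOL-Algebra.Bij"
    "Graph_Theory.Graph_Theory"
begin

text \<open>Loops are not excluded: the identity may belong to the connection set.\<close>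

definition Cayley_graph :: "('a, 'b) monoid_scheme \<Rightarrow> 'a set \<Rightarrow> 'a pair_pre_digraph" where
  "Cayley_graph G S =
     \<lparr>pverts = carrier G,
      parcs = {(g, h). g \<in> carrier G \<and> h \<in> carrier G \<and> g \<otimes>\<^bsub>G\<^esub> inv\<^bsub>G\<^esub> h \<in> S}\<rparr>"

definition CI_graph :: "('a, 'b) monoid_scheme \<Rightarrow> 'a set \<Rightarrow> bool" where
  "CI_graph G S \<longleftrightarrow>
     (\<forall>T. T \<subseteq> carrier G \<longrightarrow>
        (digraph_iso (with_proj (Cayley_graph G S)) (with_proj (Cayley_graph G T)) \<longleftrightarrow>
         (\<exists>\<sigma> \<in> auto G. \<sigma> ` S = T)))"

text \<open>
  \<^const>\<open>digraph_iso\<close> is stated for multigraphs with an explicit action on arcs; on Cayley graphs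
  it amounts to an adjacency-preserving bijection of the vertices.
\<close>

lemma digraph_iso_Cayley_graph_iff:
  "digraph_iso (with_proj (Cayley_graph G S)) (with_proj (Cayley_graph G T)) \<longleftrightarrow>
   (\<exists>f. bij_betw f (carrier G) (carrier G) \<and>
        (\<forall>g \<in> carrier G. \<forall>h \<in> carrier G.
           g \<otimes>\<^bsub>G\<^esub> inv\<^bsub>G\<^esub> h \<in> S \<longleftrightarrow> f g \<otimes>\<^bsub>G\<^esub> inv\<^bsub>G\<^esub> (f h) \<in> T))"
  (is "?L \<longleftrightarrow> (\<exists>f. ?P f)")
proof
  let ?G = "with_proj (Cayley_graph G S)" and ?H = "with_proj (Cayley_graph G T)"
  assume ?L
  then obtain k where k: "pre_digraph.digraph_isomorphism ?G k" and H: "?H = app_iso k ?G"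
    unfolding digraph_iso_def by blast
  let ?f = "iso_verts k"
  have th: "iso_tail k = fst" "iso_head k = snd"
    using arg_cong[OF H, of tail] arg_cong[OF H, of head] by simp_all
  have v: "carrier G = ?f ` carrier G"
    using arg_cong[OF H, of verts] by (simp add: Cayley_graph_def)
  have a: "parcs (Cayley_graph G T) = iso_arcs k ` parcs (Cayley_graph G S)"
    using arg_cong[OF H, of arcs] by simp
  have inj: "inj_on ?f (carrier G)"
    using k by (simp add: pre_digraph.digraph_isomorphism_def Cayley_graph_def)
  have arc: "iso_arcs k e = (?f (fst e), ?f (snd e))" if "e \<in> parcs (Cayley_graph G S)" for e
    using k that th by (auto simp: pre_digraph.digraph_isomorphism_def prod_eq_iff)
  have eq: "parcs (Cayley_graph G T) = (\<lambda>(g, h). (?f g, ?f h)) ` parcs (Cayley_graph G S)"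
    unfolding a by (rule image_cong) (auto simp: arc)
  have "g \<otimes>\<^bsub>G\<^esub> inv\<^bsub>G\<^esub> h \<in> S \<longleftrightarrow> ?f g \<otimes>\<^bsub>G\<^esub> inv\<^bsub>G\<^esub> (?f h) \<in> T"
    if gh: "g \<in> carrier G" "h \<in> carrier G" for g h
  proof -
    have "(g, h) \<in> parcs (Cayley_graph G S) \<longleftrightarrow> (?f g, ?f h) \<in> parcs (Cayley_graph G T)"
    proof
      assume "(?f g, ?f h) \<in> parcs (Cayley_graph G T)"
      then obtain g' h' where gh': "(g', h') \<in> parcs (Cayley_graph G S)" "?f g = ?f g'" "?f h = ?f h'"
        unfolding eq by auto
      then have "g' \<in> carrier G" "h' \<in> carrier G" by (auto simp: Cayley_graph_def)
      with gh' gh inj show "(g, h) \<in> parcs (Cayley_graph G S)" by (metis inj_onD)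
    qed (force simp: eq)
    moreover have "?f g \<in> carrier G" "?f h \<in> carrier G" using v gh by blast+
    ultimately show ?thesis using gh by (simp add: Cayley_graph_def)
  qed
  then have "?P ?f" using inj v[symmetric] by (simp add: bij_betw_def)
  then show "\<exists>f. ?P f" by blast
next
  let ?G = "with_proj (Cayley_graph G S)" and ?H = "with_proj (Cayley_graph G T)"
  assume "\<exists>f. ?P f"
  then obtain f where inj: "inj_on f (carrier G)" and im: "f ` carrier G = carrier G"
    and adj: "\<And>g h. g \<in> carrier G \<Longrightarrow> h \<in> carrier G \<Longrightarrow>
           g \<otimes>\<^bsub>G\<^esub> inv\<^bsub>G\<^esub> h \<in> S \<longleftrightarrow> f g \<otimes>\<^bsub>G\<^esub> inv\<^bsub>G\<^esub> (f h) \<in> T"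
    by (auto simp: bij_betw_def)
  let ?k = "\<lparr>iso_verts = f, iso_arcs = (\<lambda>(g, h). (f g, f h)), iso_head = snd, iso_tail = fst\<rparr>"
  have wf: "wf_digraph ?G" by unfold_locales (auto simp: Cayley_graph_def)
  have "pre_digraph.digraph_isomorphism ?G ?k"
    using wf inj unfolding pre_digraph.digraph_isomorphism_def
    by (auto simp: Cayley_graph_def inj_on_def)
  moreover have "parcs (Cayley_graph G T) = (\<lambda>(g, h). (f g, f h)) ` parcs (Cayley_graph G S)"
  proof (intro equalityI subsetI)
    fix e assume e: "e \<in> parcs (Cayley_graph G T)"
    obtain x y where xy: "e = (x, y)" by (cases e)
    with e have "x \<in> f ` carrier G" "y \<in> f ` carrier G" unfolding im by (auto simp: Cayley_graph_def)
    then obtain g h where gh: "g \<in> carrier G" "h \<in> carrier G" "x = f g" "y = f h" by blast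
    then have "(g, h) \<in> parcs (Cayley_graph G S)" using e xy adj by (simp add: Cayley_graph_def)
    then show "e \<in> (\<lambda>(g, h). (f g, f h)) ` parcs (Cayley_graph G S)" using gh xy by force
  next
    fix e assume "e \<in> (\<lambda>(g, h). (f g, f h)) ` parcs (Cayley_graph G S)"
    then show "e \<in> parcs (Cayley_graph G T)" using im adj by (auto simp: Cayley_graph_def)
  qed
  then have "?H = app_iso ?k ?G"
    using im by (simp add: app_iso_def with_proj_def Cayley_graph_def)
  ultimately show ?L unfolding digraph_iso_def by blast
qed

end

theory Submission
  imports Defs "HOL-Number_Theory.Number_Theory"
begin

text \<open>
  Write \<open>\<int>\<^sub>p\<^bsup>2p+3\<^esup> = U \<oplus> W\<close> with \<open>U = \<int>\<^sub>p\<^bsup>3\<^esup>\<close>. A map \<open>(u, w) \<mapsto> (u, w + \<phi> u)\<close> with \<open>\<phi> 0 = 0\<close> carries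
  \<open>Cay(S)\<close> to \<open>Cay(T)\<close> as soon as, in every direction \<open>a\<close> of a set \<open>A = -A\<close>, the fibre of \<open>S\<close> over
  \<open>a\<close> is the kernel of a functional \<open>\<lambda>\<^sub>a\<close> on \<open>W\<close> with \<open>\<lambda>\<^sub>a(\<phi>(u + a) - \<phi> u) = \<lambda>\<^sub>a(\<phi> a)\<close> for all \<open>u\<close>, the
  fibre of \<open>T\<close> is its translate by \<open>\<phi> a\<close>, both fibres over \<open>0\<close> are \<open>W\<close> and all other fibres are empty.

  If \<open>A\<close> contains no \<open>a\<close> together with \<open>2a\<close> (for \<open>A\<close> below this needs \<open>p > 3\<close>), then \<open>W\<close> is the only
  subgroup of its order in \<open>S\<close> or \<open>T\<close>, so a group automorphism \<open>\<sigma>\<close> with \<open>\<sigma> S = T\<close> preserves \<open>W\<close>,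
  and \<open>\<sigma> U\<close> is the graph of a linear \<open>L : U \<rightarrow> W\<close> with \<open>\<lambda>\<^sub>a(L a) = \<lambda>\<^sub>a(\<phi> a)\<close> on \<open>A\<close>.

  For such an \<open>L\<close> not to exist, \<open>\<phi>\<close> must have degree at least \<open>p\<close>. Take \<open>A\<close> to consist of
  \<open>\<plusminus>(1, s, t)\<close> and \<open>\<plusminus>(0, 1, t)\<close>, and let the components of \<open>\<phi>\<close> be the monomials of degree \<open>p\<close>
  spanning the forms \<open>(y - s x) (z - t x)\<^bsup>p-1\<^esup>\<close> modulo \<open>x\<^bsup>p\<^esup>\<close>. As \<open>x\<^bsup>p\<^esup> = x\<close> on \<open>\<int>\<^sub>p\<close>, dropping
  this term turns invariance along \<open>(1, s, t)\<close> into growth by \<open>s t\<^bsup>p-1\<^esup>\<close>. The directions \<open>(0, 1, t)\<close>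
  carry the forms \<open>x\<^bsup>p-1\<^esup> (z - t y)\<close>. Comparing the coefficients of \<open>s t\<^bsup>p-1\<^esup>\<close> and of \<open>t\<close> gives two
  contradictory linear conditions on \<open>L\<close>.
\<close>

section \<open>Fermat's theorem and power sums modulo \<open>p\<close>\<close>

lemma fermat_int:
  fixes a :: int
  assumes "prime p" "\<not> [a = 0] (mod int p)"
  shows "[a ^ (p - 1) = 1] (mod int p)"
proof -
  have p0: "0 < int p" using assms(1) prime_gt_0_nat by simp
  define b where "b = nat (a mod int p)"
  have b: "int b = a mod int p" using p0 by (simp add: b_def)
  have "\<not> p dvd b"
    using assms(2) b by (metis cong_0_iff cong_mod_left int_dvd_int_iff cong_refl)
  then have "[b ^ (p - 1) = 1] (mod p)" using fermat_theorem assms(1) by blast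
  then have "[int b ^ (p - 1) = 1] (mod int p)"
    by (metis cong_int_iff of_nat_1 of_nat_power)
  then show ?thesis unfolding b by (simp add: cong_def power_mod)
qed

lemma fermat_int_power_self:
  fixes a :: int
  assumes "prime p"
  shows "[a ^ p = a] (mod int p)"
proof (cases "[a = 0] (mod int p)")
  case True
  then have "int p dvd a" by (simp add: cong_0_iff)
  then show ?thesis using assms
    by (metis cong_0_iff cong_sym cong_trans dvd_power dvd_trans prime_gt_0_nat)
next
  case False
  have "[a * a ^ (p - 1) = a * 1] (mod int p)"
    by (intro cong_scalar_left fermat_int assms False)
  moreover have "a * a ^ (p - 1) = a ^ p"
    using assms prime_gt_0_nat by (simp add: power_eq_if)
  ultimately show ?thesis by simp
qed

lemma sum_lessThan_split_first:
  fixes f :: "nat \<Rightarrow> 'a :: comm_monoid_add"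
  assumes "p > 0"
  shows "(\<Sum>c<p. f c) = f 0 + (\<Sum>c=1..<p. f c)"
  using sum.atLeast_Suc_lessThan[OF assms, of f] by (simp only: lessThan_atLeast0 One_nat_def)

text \<open>Telescoping \<open>(t + 1) ^ (k + 1) - t ^ (k + 1)\<close> over \<open>t < p\<close>
  gives \<open>p ^ (k + 1)\<close>. After binomial expansion the lower power sums vanish by
  induction, and the factor \<open>k + 1 < p\<close> of the last one cancels.\<close>

lemma power_sum_cong_0:
  assumes "prime p" "k < p - 1"
  shows "[(\<Sum>t<p. int t ^ k) = 0] (mod int p)"
  using assms(2)
proof (induction k rule: less_induct)
  case (less k)
  have "(\<Sum>t<p. int (Suc t) ^ Suc k - int t ^ Suc k) = int p ^ Suc k - 0 ^ Suc k"
    by (subst sum_lessThan_telescope) simp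
  also have "(\<Sum>t<p. int (Suc t) ^ Suc k - int t ^ Suc k)
      = (\<Sum>t<p. \<Sum>j\<le>k. int (Suc k choose j) * int t ^ j)"
  proof (rule sum.cong[OF refl])
    fix t
    have "int (Suc t) ^ Suc k = (int t + 1) ^ Suc k" by (simp add: add.commute)
    also have "\<dots> = (\<Sum>j\<le>Suc k. int (Suc k choose j) * int t ^ j)"
      by (subst binomial_ring) simp
    finally show "int (Suc t) ^ Suc k - int t ^ Suc k = (\<Sum>j\<le>k. int (Suc k choose j) * int t ^ j)"
      by (simp only: sum.atMost_Suc) simp
  qed
  also have "\<dots> = (\<Sum>j\<le>k. int (Suc k choose j) * (\<Sum>t<p. int t ^ j))"
    by (subst sum.swap) (simp add: sum_distrib_left)
  also have "\<dots> = (\<Sum>j<k. int (Suc k choose j) * (\<Sum>t<p. int t ^ j))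
      + int (Suc k) * (\<Sum>t<p. int t ^ k)"
    by (simp add: lessThan_Suc_atMost[symmetric])
  finally have eq: "(\<Sum>j<k. int (Suc k choose j) * (\<Sum>t<p. int t ^ j))
      + int (Suc k) * (\<Sum>t<p. int t ^ k) = int p ^ Suc k" by simp
  have d: "int p dvd (\<Sum>j<k. int (Suc k choose j) * (\<Sum>t<p. int t ^ j))"
  proof (rule dvd_sum, rule dvd_mult)
    fix j assume "j \<in> {..<k}"
    then show "int p dvd (\<Sum>t<p. int t ^ j)" using less by (simp add: cong_0_iff)
  qed
  have "int p dvd int p ^ Suc k" by simp
  then have "int p dvd int (Suc k) * (\<Sum>t<p. int t ^ k)"
    unfolding eq[symmetric] dvd_add_right_iff[OF d] .
  moreover have "\<not> int p dvd int (Suc k)"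
    using less.prems by (simp only: int_dvd_int_iff) (auto dest: dvd_imp_le)
  ultimately have "int p dvd (\<Sum>t<p. int t ^ k)"
    using assms(1) by (meson prime_dvd_mult_iff prime_nat_int_transfer)
  then show ?case by (simp add: cong_0_iff)
qed

lemma power_sum_cong_minus_1:
  assumes "prime p"
  shows "[(\<Sum>t<p. int t ^ (p - 1)) = - 1] (mod int p)"
proof -
  have p: "p > 1" using assms prime_gt_1_nat by blast
  have "[(\<Sum>t\<in>{1..<p}. int t ^ (p - 1)) = (\<Sum>t\<in>{1..<p}. 1)] (mod int p)"
  proof (intro cong_sum fermat_int assms)
    fix t assume "t \<in> {1..<p}"
    then show "\<not> [int t = 0] (mod int p)"
      by (simp only: cong_0_iff int_dvd_int_iff) (auto dest: dvd_imp_le)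
  qed
  moreover have "(\<Sum>t<p. int t ^ (p - 1)) = (\<Sum>t\<in>{1..<p}. int t ^ (p - 1))"
    using p by (subst sum_lessThan_split_first) auto
  moreover have "[(\<Sum>t\<in>{1..<p}. 1) = - 1] (mod int p)"
    using p by (simp add: cong_iff_dvd_diff of_nat_diff)
  ultimately show ?thesis using cong_trans by metis
qed

text \<open>By Fermat, the left-hand side is \<open>(z - u) ^ (p - 1)\<close> modulo \<open>p\<close>.\<close>

lemma geometric_sum_cong:
  fixes u z :: int
  assumes "prime p"
  shows "[(\<Sum>c<p. u ^ (p - 1 - c) * z ^ c) = (if [z = u] (mod int p) then 0 else 1)] (mod int p)"
proof (cases "[z = u] (mod int p)")
  case True
  have "[(\<Sum>c<p. u ^ (p - 1 - c) * z ^ c) = (\<Sum>c<p. u ^ (p - 1 - c) * u ^ c)] (mod int p)"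
    by (intro cong_sum cong_scalar_left cong_pow True)
  also have "(\<Sum>c<p. u ^ (p - 1 - c) * u ^ c) = (\<Sum>c<p. u ^ (p - 1))"
    by (intro sum.cong refl) (simp add: power_add[symmetric])
  also have "[(\<Sum>c<p. u ^ (p - 1)) = 0] (mod int p)" by (simp add: cong_0_iff)
  finally show ?thesis using True by simp
next
  case False
  let ?N = "\<Sum>c<p. u ^ (p - 1 - c) * z ^ c"
  \<comment> \<open>Multiplication by \<open>z - u\<close>, a unit here, telescopes the sum; Fermat
    reduces \<open>z ^ p - u ^ p\<close> to \<open>z - u\<close>.\<close>
  have "(z - u) * ?N = z ^ p - u ^ p"
    by (subst power_diff_sumr2) (simp add: mult.commute)
  also have "[z ^ p - u ^ p = z - u] (mod int p)"
    by (intro cong_diff fermat_int_power_self assms)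
  finally have "[(z - u) * ?N = (z - u) * 1] (mod int p)" by simp
  moreover have "\<not> int p dvd z - u" using False by (simp add: cong_iff_dvd_diff)
  then have "coprime (z - u) (int p)"
    using assms by (metis coprime_commute prime_imp_coprime prime_nat_int_transfer)
  ultimately have "[?N = 1] (mod int p)" using cong_mult_lcancel by blast
  then show ?thesis using False by simp
qed

section \<open>The forms, the connection sets and the twist\<close>

text \<open>
  Integer vectors stand for their classes modulo \<open>p\<close>. Coordinates \<open>0, 1, 2\<close> are \<open>x, y, z\<close>; coordinate
  \<open>3 + c\<close> is dual to \<open>x\<^bsup>p-c\<^esup> z\<^bsup>c\<^esup>\<close> for \<open>0 < c < p\<close> and coordinate \<open>3 + p + c\<close> to
  \<open>y x\<^bsup>p-1-c\<^esup> z\<^bsup>c\<^esup>\<close> for \<open>c < p\<close>; coordinate \<open>3\<close> is a dummy. Since \<open>(z - t x)\<^bsup>p-1\<^esup>\<close> is the sum of the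
  \<open>(t x)\<^bsup>p-1-c\<^esup> z\<^bsup>c\<^esup>\<close> modulo \<open>p\<close>, the functional \<open>affine_form p s t\<close> represents
  \<open>(y - s x) (z - t x)\<^bsup>p-1\<^esup>\<close> without its \<open>x\<^bsup>p\<^esup>\<close> term.
\<close>

definition affine_form :: "nat \<Rightarrow> int \<Rightarrow> int \<Rightarrow> (nat \<Rightarrow> int) \<Rightarrow> int" where
  "affine_form p s t v = (\<Sum>c<p. t ^ (p - 1 - c) * v (3 + p + c))
     - s * (\<Sum>c=1..<p. t ^ (p - 1 - c) * v (3 + c))"

text \<open>Coordinate \<open>4\<close> is dual to \<open>x ^ (p - 1) z\<close> and
  \<open>3 + p\<close> to \<open>y x ^ (p - 1)\<close>, so this represents
  \<open>x ^ (p - 1) (z - t y)\<close>. The directions \<open>(0, 1, t)\<close> lie at infinity for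
  the parameters \<open>(s, t)\<close>.\<close>

definition infinite_form :: "nat \<Rightarrow> int \<Rightarrow> (nat \<Rightarrow> int) \<Rightarrow> int" where
  "infinite_form p t v = v 4 - t * v (3 + p)"

definition lies_over :: "nat \<Rightarrow> (nat \<Rightarrow> int) \<Rightarrow> int \<Rightarrow> int \<Rightarrow> int \<Rightarrow> bool" where
  "lies_over p v x y z \<longleftrightarrow> [v 0 = x] (mod int p) \<and> [v 1 = y] (mod int p) \<and> [v 2 = z] (mod int p)"

text \<open>The connection sets are given by \<open>k = 0\<close> for \<open>S\<close> and \<open>k = 1\<close> for \<open>T\<close>.\<close>

definition connection :: "nat \<Rightarrow> int \<Rightarrow> (nat \<Rightarrow> int) \<Rightarrow> bool" where
  "connection p k v \<longleftrightarrow> lies_over p v 0 0 0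
    \<or> (\<exists>e s t. e \<in> {1, -1} \<and> lies_over p v e (e * s) (e * t)
         \<and> [affine_form p s t v = k * e * s * t ^ (p - 1)] (mod int p))
    \<or> (\<exists>e t. e \<in> {1, -1} \<and> lies_over p v 0 e (e * t) \<and> [infinite_form p t v = 0] (mod int p))"

definition vcong :: "nat \<Rightarrow> (nat \<Rightarrow> int) \<Rightarrow> (nat \<Rightarrow> int) \<Rightarrow> bool" where
  "vcong p v w \<longleftrightarrow> (\<forall>i < 2 * p + 3. [v i = w i] (mod int p))"

text \<open>The map \<open>\<phi>\<close>: each component is the monomial that its coordinate is
  dual to.\<close>

definition twist :: "nat \<Rightarrow> (nat \<Rightarrow> int) \<Rightarrow> nat \<Rightarrow> int" where
  "twist p v i = (if 3 < i \<and> i < 3 + p then v 0 ^ (3 + p - i) * v 2 ^ (i - 3)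
     else if 3 + p \<le> i then v 1 * v 0 ^ (2 * p + 2 - i) * v 2 ^ (i - (3 + p)) else 0)"

section \<open>Linearity of the forms and invariance under congruence\<close>

lemma affine_form_add: "affine_form p s t (\<lambda>i. v i + w i) = affine_form p s t v + affine_form p s t w"
  by (simp add: affine_form_def sum.distrib algebra_simps)

lemma affine_form_diff: "affine_form p s t (\<lambda>i. v i - w i) = affine_form p s t v - affine_form p s t w"
  by (simp add: affine_form_def sum_subtractf algebra_simps)

lemma affine_form_scale: "affine_form p s t (\<lambda>i. r * v i) = r * affine_form p s t v"
  by (simp add: affine_form_def sum_distrib_left algebra_simps)

lemma affine_form_cong:
  assumes "vcong p v w" "[s = s'] (mod int p)" "[t = t'] (mod int p)"
  shows "[affine_form p s t v = affine_form p s' t' w] (mod int p)"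
  unfolding affine_form_def using assms(1)
  by (intro cong_diff cong_mult cong_sum cong_pow assms(2,3)) (auto simp: vcong_def)

lemma infinite_form_cong:
  assumes "vcong p v w" "[t = t'] (mod int p)" "p > 1"
  shows "[infinite_form p t v = infinite_form p t' w] (mod int p)"
  unfolding infinite_form_def using assms(1,3)
  by (intro cong_diff cong_mult assms(2)) (auto simp: vcong_def)

lemma vcong_sym: "vcong p v w \<Longrightarrow> vcong p w v"
  by (auto simp: vcong_def cong_sym)

lemma vcong_trans: "vcong p u v \<Longrightarrow> vcong p v w \<Longrightarrow> vcong p u w"
  unfolding vcong_def using cong_trans by blast

lemma lies_over_vcong:
  assumes "vcong p v w" shows "lies_over p v x y z \<longleftrightarrow> lies_over p w x y z"
proof -
  have "[v i = w i] (mod int p)" if "i < 3" for i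
    using assms that by (simp add: vcong_def)
  then have "[v 0 = w 0] (mod int p)" "[v 1 = w 1] (mod int p)" "[v 2 = w 2] (mod int p)"
    by simp_all
  then show ?thesis unfolding lies_over_def by (meson cong_trans cong_sym)
qed

lemma connection_vcong:
  assumes "vcong p v w" "p > 1" "connection p k v" shows "connection p k w"
proof -
  have "[affine_form p s t v = a] (mod int p) \<longleftrightarrow> [affine_form p s t w = a] (mod int p)" for s t a
    using affine_form_cong[OF assms(1) cong_refl cong_refl] by (meson cong_trans cong_sym)
  moreover have "[infinite_form p t v = a] (mod int p) \<longleftrightarrow> [infinite_form p t w = a] (mod int p)" for t a
    using infinite_form_cong[OF assms(1) cong_refl assms(2)] by (meson cong_trans cong_sym)
  ultimately show ?thesis using assms(3) lies_over_vcong[OF assms(1)] unfolding connection_def by simp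
qed

text \<open>Negation exchanges \<open>e = 1\<close> and \<open>e = -1\<close>; this makes the graph
  of \<open>S\<close> undirected.\<close>

lemma connection_0_uminus:
  assumes "connection p 0 v" shows "connection p 0 (\<lambda>i. - v i)"
proof -
  have neg: "lies_over p (\<lambda>i. - v i) (- x) (- y) (- z)" if "lies_over p v x y z" for x y z
    using that by (simp add: lies_over_def cong_minus_minus_iff)
  have l: "[affine_form p s t (\<lambda>i. - v i) = 0] (mod int p)" if "[affine_form p s t v = 0] (mod int p)" for s t
    using that affine_form_scale[of p s t "- 1" v] by (simp add: cong_0_iff)
  have m: "[infinite_form p t (\<lambda>i. - v i) = 0] (mod int p)" if "[infinite_form p t v = 0] (mod int p)" for t
    using that by (simp add: infinite_form_def cong_0_iff)
      (metis dvd_diff_commute minus_diff_eq uminus_add_conv_diff diff_minus_eq_add add.commute)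
  from assms consider "lies_over p v 0 0 0"
    | e s t where "e \<in> {1, -1}" "lies_over p v e (e * s) (e * t)" "[affine_form p s t v = 0] (mod int p)"
    | e t where "e \<in> {1, -1}" "lies_over p v 0 e (e * t)" "[infinite_form p t v = 0] (mod int p)"
    unfolding connection_def mult_zero_left by blast
  then show ?thesis
  proof cases
    case 1 then show ?thesis using neg unfolding connection_def by fastforce
  next
    case 2
    then have "- e \<in> {1, -1}" "lies_over p (\<lambda>i. - v i) (- e) (- e * s) (- e * t)"
      using neg by fastforce+
    then show ?thesis using l[OF 2(3)] unfolding connection_def by (metis mult_zero_left)
  next
    case 3
    then have "- e \<in> {1, -1}" "lies_over p (\<lambda>i. - v i) 0 (- e) (- e * t)"
      using neg by fastforce+
    then show ?thesis using m[OF 3(3)] unfolding connection_def by blast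
  qed
qed

section \<open>The twist and the two connection sets\<close>

lemma affine_form_twist:
  assumes "prime p"
  shows "[affine_form p s t (twist p v) = (v 1 - s * v 0) * (if [v 2 = t * v 0] (mod int p) then 0 else 1)
            + s * t ^ (p - 1) * v 0] (mod int p)"
proof -
  have p: "p > 0" using assms prime_gt_0_nat by blast
  define N where "N = (\<Sum>c<p. (t * v 0) ^ (p - 1 - c) * v 2 ^ c)"
  have 1: "(\<Sum>c<p. t ^ (p - 1 - c) * twist p v (3 + p + c)) = v 1 * N"
    unfolding N_def sum_distrib_left
  proof (rule sum.cong[OF refl])
    fix c assume "c \<in> {..<p}"
    then have "2 * p + 2 - (3 + p + c) = p - 1 - c" by auto
    then show "t ^ (p - 1 - c) * twist p v (3 + p + c) = v 1 * ((t * v 0) ^ (p - 1 - c) * v 2 ^ c)"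
      by (simp add: twist_def power_mult_distrib)
  qed
  have 2: "(\<Sum>c=1..<p. t ^ (p - 1 - c) * twist p v (3 + c))
      = (\<Sum>c=1..<p. v 0 * ((t * v 0) ^ (p - 1 - c) * v 2 ^ c))"
  proof (rule sum.cong[OF refl])
    fix c assume c: "c \<in> {1..<p}"
    then have "v 0 ^ (p - c) = v 0 * v 0 ^ (p - 1 - c)"
      by (simp add: power_Suc[symmetric] del: power_Suc) (metis Suc_diff_Suc diff_Suc_eq_diff_pred)
    with c show "t ^ (p - 1 - c) * twist p v (3 + c) = v 0 * ((t * v 0) ^ (p - 1 - c) * v 2 ^ c)"
      by (simp add: twist_def power_mult_distrib)
  qed
  have 3: "N = (t * v 0) ^ (p - 1) + (\<Sum>c=1..<p. (t * v 0) ^ (p - 1 - c) * v 2 ^ c)"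
    using p unfolding N_def by (subst sum_lessThan_split_first) auto
  have h: "v 0 * (t * v 0) ^ (p - 1) = t ^ (p - 1) * v 0 ^ p"
    using power_minus_mult[OF p, of "v 0"] by (simp add: power_mult_distrib mult_ac)
  \<comment> \<open>\<open>A\<close> stands for the term \<open>c = 0\<close> of \<open>N\<close>
    and \<open>M\<close> for the rest. The second sum of \<open>affine_form\<close> lacks
    \<open>A\<close>, which leaves \<open>s * X\<close> over.\<close>
  have gen: "v 1 * (A + M) - s * (v 0 * M) = (v 1 - s * v 0) * (A + M) + s * X"
    if "v 0 * A = X" for A M X :: int unfolding that[symmetric] by (simp add: algebra_simps)
  have eq: "affine_form p s t (twist p v) = (v 1 - s * v 0) * N + s * t ^ (p - 1) * v 0 ^ p"
    unfolding affine_form_def 1 2 sum_distrib_left[symmetric] using gen[OF h] by (simp only: 3 mult.assoc)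
  show ?thesis unfolding eq N_def
    by (intro cong_add cong_scalar_left geometric_sum_cong fermat_int_power_self assms)
qed

text \<open>A step along \<open>(1, s, t)\<close> changes neither \<open>y - s x\<close> nor the
  truth of \<open>z = t x\<close>, so the form of the twist grows only by
  \<open>e * s * t ^ (p - 1)\<close>. A step along \<open>(0, 1, t)\<close> changes neither
  \<open>x\<close> nor \<open>z - t y\<close>.\<close>

lemma connection_shift_twist:
  assumes "prime p"
  shows "connection p 1 (\<lambda>i. (v i + twist p v i) - (w i + twist p w i)) \<longleftrightarrow> connection p 0 (\<lambda>i. v i - w i)"
proof -
  let ?d = "\<lambda>i. v i - w i" and ?D = "\<lambda>i. (v i + twist p v i) - (w i + twist p w i)"
  have o: "lies_over p ?D x y z \<longleftrightarrow> lies_over p ?d x y z" for x y z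
    by (simp add: lies_over_def twist_def)
  have l: "[affine_form p s t ?D = 1 * e * s * t ^ (p - 1)] (mod int p) \<longleftrightarrow>
      [affine_form p s t ?d = 0 * e * s * t ^ (p - 1)] (mod int p)"
    if "lies_over p ?d e (e * s) (e * t)" for e s t
  proof -
    have h: "[v 0 = w 0 + e] (mod int p)" "[v 1 = w 1 + e * s] (mod int p)" "[v 2 = w 2 + e * t] (mod int p)"
      using that by (simp_all add: lies_over_def cong_iff_dvd_diff algebra_simps)
    have "[v 1 - s * v 0 = (w 1 + e * s) - s * (w 0 + e)] (mod int p)"
      by (intro cong_diff cong_scalar_left h)
    then have h1: "[v 1 - s * v 0 = w 1 - s * w 0] (mod int p)" by (simp add: algebra_simps)
    have "[v 2 - t * v 0 = (w 2 + e * t) - t * (w 0 + e)] (mod int p)"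
      by (intro cong_diff cong_scalar_left h)
    then have "[v 2 - t * v 0 = w 2 - t * w 0] (mod int p)" by (simp add: algebra_simps)
    then have h2: "[v 2 = t * v 0] (mod int p) \<longleftrightarrow> [w 2 = t * w 0] (mod int p)"
      by (metis cong_diff_iff_cong_0 cong_sym cong_trans)
    let ?n = "if [w 2 = t * w 0] (mod int p) then 0 else 1 :: int"
    have "[affine_form p s t (twist p v) - affine_form p s t (twist p w)
       = ((v 1 - s * v 0) * ?n + s * t ^ (p - 1) * v 0) - ((w 1 - s * w 0) * ?n + s * t ^ (p - 1) * w 0)] (mod int p)"
      using affine_form_twist[OF assms, of s t v] affine_form_twist[OF assms, of s t w] unfolding h2 by (rule cong_diff)
    also have "[((v 1 - s * v 0) * ?n + s * t ^ (p - 1) * v 0) - ((w 1 - s * w 0) * ?n + s * t ^ (p - 1) * w 0)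
       = ((w 1 - s * w 0) * ?n + s * t ^ (p - 1) * (w 0 + e)) - ((w 1 - s * w 0) * ?n + s * t ^ (p - 1) * w 0)] (mod int p)"
      by (intro cong_diff cong_add cong_scalar_left cong_scalar_right h h1 cong_refl)
    finally have "[affine_form p s t (twist p v) - affine_form p s t (twist p w) = e * s * t ^ (p - 1)] (mod int p)"
      by (simp add: algebra_simps)
    then have "[affine_form p s t ?d + (affine_form p s t (twist p v) - affine_form p s t (twist p w))
        = affine_form p s t ?d + e * s * t ^ (p - 1)] (mod int p)"
      by (rule cong_add[OF cong_refl])
    moreover have "affine_form p s t ?D = affine_form p s t ?d + (affine_form p s t (twist p v) - affine_form p s t (twist p w))"
      by (simp add: affine_form_add affine_form_diff)
    ultimately have "[affine_form p s t ?D = affine_form p s t ?d + e * s * t ^ (p - 1)] (mod int p)" by simp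
    then have "[affine_form p s t ?D = e * s * t ^ (p - 1)] (mod int p) \<longleftrightarrow>
       [affine_form p s t ?d + e * s * t ^ (p - 1) = 0 + e * s * t ^ (p - 1)] (mod int p)"
      by (simp add: cong_def)
    then show ?thesis by (simp only: cong_add_rcancel) simp
  qed
  have m: "[infinite_form p t ?D = 0] (mod int p) \<longleftrightarrow> [infinite_form p t ?d = 0] (mod int p)"
    if "lies_over p ?d 0 e (e * t)" for e t
  proof -
    have p: "p > 1" using assms prime_gt_1_nat by blast
    have h: "[v 0 = w 0] (mod int p)" "[v 1 = w 1 + e] (mod int p)" "[v 2 = w 2 + e * t] (mod int p)"
      using that by (simp_all add: lies_over_def cong_iff_dvd_diff algebra_simps)
    have f: "infinite_form p t (twist p u) = u 0 ^ (p - 1) * (u 2 - t * u 1)" for u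
      using p by (simp add: infinite_form_def twist_def algebra_simps)
    have "[v 0 ^ (p - 1) * (v 2 - t * v 1) = w 0 ^ (p - 1) * ((w 2 + e * t) - t * (w 1 + e))] (mod int p)"
      by (intro cong_mult cong_diff cong_pow h cong_refl)
    then have "[infinite_form p t (twist p v) = infinite_form p t (twist p w)] (mod int p)"
      unfolding f by (simp add: algebra_simps)
    then have "[infinite_form p t ?d + (infinite_form p t (twist p v) - infinite_form p t (twist p w))
        = infinite_form p t ?d + 0] (mod int p)"
      by (intro cong_add cong_refl) (simp add: cong_iff_dvd_diff)
    moreover have "infinite_form p t ?D = infinite_form p t ?d + (infinite_form p t (twist p v) - infinite_form p t (twist p w))"
      by (simp add: infinite_form_def algebra_simps)
    ultimately show ?thesis by (simp add: cong_def)
  qed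
  have l': "lies_over p ?d e (e * s) (e * t) \<and> [affine_form p s t ?D = 1 * e * s * t ^ (p - 1)] (mod int p) \<longleftrightarrow>
      lies_over p ?d e (e * s) (e * t) \<and> [affine_form p s t ?d = 0 * e * s * t ^ (p - 1)] (mod int p)" for e s t
    using l by blast
  have m': "lies_over p ?d 0 e (e * t) \<and> [infinite_form p t ?D = 0] (mod int p) \<longleftrightarrow>
      lies_over p ?d 0 e (e * t) \<and> [infinite_form p t ?d = 0] (mod int p)" for e t
    using m by blast
  show ?thesis unfolding connection_def o l' m' ..
qed

section \<open>Fibres of the connection sets\<close>

text \<open>The leading coordinate forces \<open>e = 1\<close>, since \<open>p\<close> does not
  divide \<open>2\<close>; then \<open>s\<close> and \<open>t\<close> are determined modulo
  \<open>p\<close>.\<close>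

lemma connection_lies_over_1:
  assumes "p > 3" "connection p k v" "lies_over p v 1 s t"
  shows "[affine_form p s t v = k * s * t ^ (p - 1)] (mod int p)"
proof -
  have nd: "\<not> int p dvd 1" "\<not> int p dvd 2"
    using assms(1) by (auto dest: zdvd_imp_le)
  have v: "[v 0 = 1] (mod int p)" "[v 1 = s] (mod int p)" "[v 2 = t] (mod int p)"
    using assms(3) by (auto simp: lies_over_def)
  have no: "\<not> lies_over p v 0 y z" for y z
    using v nd unfolding lies_over_def by (metis cong_0_iff cong_sym cong_trans)
  with assms(2) obtain e s' t' where e: "e \<in> {1, -1}" "lies_over p v e (e * s') (e * t')"
    "[affine_form p s' t' v = k * e * s' * t' ^ (p - 1)] (mod int p)" unfolding connection_def by blast
  have "[1 = e] (mod int p)" using e(2) v(1) unfolding lies_over_def cong_def by simp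
  then have "e = 1" using e(1) nd by (auto simp: cong_iff_dvd_diff)
  with e have e': "[v 1 = s'] (mod int p)" "[v 2 = t'] (mod int p)"
    "[affine_form p s' t' v = k * s' * t' ^ (p - 1)] (mod int p)" by (auto simp: lies_over_def)
  have c: "[s = s'] (mod int p)" "[t = t'] (mod int p)"
    using e' v by (metis cong_sym cong_trans)+
  have "[affine_form p s t v = affine_form p s' t' v] (mod int p)"
    by (rule affine_form_cong[OF _ c]) (simp add: vcong_def)
  also note e'(3)
  also have "[k * s' * t' ^ (p - 1) = k * s * t ^ (p - 1)] (mod int p)"
    by (intro cong_mult cong_pow cong_refl cong_sym[OF c(1)] cong_sym[OF c(2)])
  finally show ?thesis .
qed

lemma connection_lies_over_0_1:
  assumes "p > 3" "connection p k v" "lies_over p v 0 1 t"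
  shows "[infinite_form p t v = 0] (mod int p)"
proof -
  have nd: "\<not> int p dvd 1" "\<not> int p dvd 2"
    using assms(1) by (auto dest: zdvd_imp_le)
  have v: "[v 0 = 0] (mod int p)" "[v 1 = 1] (mod int p)" "[v 2 = t] (mod int p)"
    using assms(3) by (auto simp: lies_over_def)
  have "\<not> lies_over p v 0 0 z" for z
    using v nd unfolding lies_over_def by (metis cong_0_iff cong_sym cong_trans)
  moreover have "\<not> lies_over p v e y z" if "e \<in> {1, -1}" for e y z
  proof
    assume "lies_over p v e y z"
    then have "[e = 0] (mod int p)" using v unfolding lies_over_def cong_def by simp
    then show False using that nd by (auto simp: cong_0_iff)
  qed
  ultimately obtain e t' where e: "e \<in> {1, -1}" "lies_over p v 0 e (e * t')"
    "[infinite_form p t' v = 0] (mod int p)" using assms(2) unfolding connection_def by blast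
  have "[1 = e] (mod int p)" using e(2) v(2) unfolding lies_over_def cong_def by simp
  then have "e = 1" using e(1) nd by (auto simp: cong_iff_dvd_diff)
  with e v have "[t = t'] (mod int p)" unfolding lies_over_def by (metis cong_sym cong_trans mult_1)
  then have "[infinite_form p t v = infinite_form p t' v] (mod int p)"
    using assms(1) by (intro infinite_form_cong) (simp_all add: vcong_def)
  then show ?thesis using e(3) cong_trans by blast
qed

text \<open>Over a direction the first coordinate that is nonzero modulo \<open>p\<close> is
  \<open>1\<close> or \<open>-1\<close>, and its double is neither \<open>0\<close> nor one of
  these. This singles out \<open>W\<close>.\<close>

lemma connection_double:
  assumes "p > 3" "connection p k v" "connection p k (\<lambda>i. v i + v i)"
  shows "lies_over p v 0 0 0"
proof (rule ccontr)
  assume n0: "\<not> lies_over p v 0 0 0"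
  have nd: "\<not> int p dvd 1" "\<not> int p dvd 2" "\<not> int p dvd 3"
    using assms(1) by (auto dest: zdvd_imp_le)
  have first: "\<exists>e y z. e \<in> {1, -1} \<and> (lies_over p u e y z \<or> lies_over p u 0 e y)" 
    if "connection p k u" "\<not> lies_over p u 0 0 0" for u
    using that unfolding connection_def by blast
  obtain e y z where e: "e \<in> {1, -1}" "lies_over p v e y z \<or> lies_over p v 0 e y"
    using first assms(2) n0 by blast
  have D: "lies_over p (\<lambda>i. v i + v i) (x + x) (y + y) (z + z)" if "lies_over p v x y z" for x y z
    using that unfolding lies_over_def by (blast intro: cong_add)
  have u: "[a = b] (mod int p)" if "lies_over p u a y z" "lies_over p u b y' z'" for u a b y z y' z'
    using that unfolding lies_over_def cong_def by simp
  have u': "[a = b] (mod int p)" if "lies_over p u c a z" "lies_over p u d b z'" for u a b c d z z'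
    using that unfolding lies_over_def cong_def by simp
  have ne: "\<not> [e + e = 0] (mod int p)" "\<not> [0 = e'] (mod int p)" "\<not> [e + e = e'] (mod int p)"
    if "e' \<in> {1, -1}" for e' using e(1) that nd by (auto simp: cong_iff_dvd_diff)
  have a: "lies_over p (\<lambda>i. v i + v i) (e + e) (y + y) (z + z) \<or> lies_over p (\<lambda>i. v i + v i) 0 (e + e) (y + y)"
    using e(2) D[of e y z] D[of 0 e y] by auto
  have "\<not> lies_over p (\<lambda>i. v i + v i) 0 0 0"
    using a ne(1)[of 1] u u' by blast
  then obtain e' y' z' where e': "e' \<in> {1, -1}"
    "lies_over p (\<lambda>i. v i + v i) e' y' z' \<or> lies_over p (\<lambda>i. v i + v i) 0 e' y'"
    using first assms(3) by blast
  from ne[OF e'(1)] a e'(2) show False using u u' by blast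
qed

section \<open>The contradictory linear conditions\<close>

text \<open>In the application \<open>a\<close>, \<open>b\<close>, \<open>d\<close> are the points
  of the graph of \<open>L\<close> over the unit vectors of \<open>U\<close>. The two hypotheses
  give \<open>d 4 - b (3 + p)\<close> the values \<open>-1\<close> and \<open>0\<close>.\<close>

lemma no_linear_interpolation:
  fixes a b d :: "nat \<Rightarrow> int"
  assumes p: "prime p" "p > 3"
    and l: "\<And>s t. [affine_form p s t (\<lambda>i. a i + s * b i + t * d i) = s * t ^ (p - 1)] (mod int p)"
    and m: "\<And>t. [infinite_form p t (\<lambda>i. b i + t * d i) = 0] (mod int p)"
  shows False
proof -
  have nd: "\<not> int p dvd 1" "\<not> int p dvd 2" 
    using p(2) by (auto dest: zdvd_imp_le)
  have cop: "coprime 2 (int p)"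
    using p nd by (metis coprime_commute prime_imp_coprime prime_nat_int_transfer)
  let ?G = "\<lambda>t v. \<Sum>c<p. t ^ (p - 1 - c) * v (3 + p + c) :: int"
  let ?F = "\<lambda>t v. \<Sum>c=1..<p. t ^ (p - 1 - c) * v (3 + c) :: int"
  have lin: "affine_form p s t (\<lambda>i. a i + s * b i + t * d i)
     = ?G t a + s * ?G t b + t * ?G t d - s * (?F t a + s * ?F t b + t * ?F t d)" for s t
    by (simp add: affine_form_def sum.distrib sum_distrib_left algebra_simps)
  \<comment> \<open>Half the difference of the values at \<open>s = 1\<close> and \<open>s = -1\<close> is the coefficient of \<open>s\<close>.\<close>
  have key: "[?G t b - ?F t a - t * ?F t d = t ^ (p - 1)] (mod int p)" for t
  proof -
    have "[affine_form p 1 t (\<lambda>i. a i + 1 * b i + t * d i) - affine_form p (-1) t (\<lambda>i. a i + (-1) * b i + t * d i)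
       = 1 * t ^ (p - 1) - (-1) * t ^ (p - 1)] (mod int p)"
      by (intro cong_diff l)
    then have "[2 * (?G t b - ?F t a - t * ?F t d) = 2 * t ^ (p - 1)] (mod int p)"
      unfolding lin by (simp add: algebra_simps)
    then show ?thesis using cong_mult_lcancel[OF cop] by blast
  qed
  let ?P = "\<lambda>k. \<Sum>t<p. int t ^ k"
  \<comment> \<open>Summation over \<open>t\<close> extracts minus the coefficient of \<open>t ^ (p - 1)\<close>.\<close>
  have tot: "[(\<Sum>t<p. ?G (int t) b - ?F (int t) a - int t * ?F (int t) d) = ?P (p - 1)] (mod int p)"
    by (intro cong_sum key)
  have eq: "(\<Sum>t<p. ?G (int t) b - ?F (int t) a - int t * ?F (int t) d)
     = (\<Sum>c<p. b (3 + p + c) * ?P (p - 1 - c)) - (\<Sum>c=1..<p. a (3 + c) * ?P (p - 1 - c))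
        - (\<Sum>c=1..<p. d (3 + c) * ?P (p - c))"
  proof -
    have "(\<Sum>t<p. ?G (int t) b) = (\<Sum>c<p. b (3 + p + c) * ?P (p - 1 - c))"
      by (subst sum.swap) (simp add: sum_distrib_left mult.commute)
    moreover have "(\<Sum>t<p. ?F (int t) a) = (\<Sum>c=1..<p. a (3 + c) * ?P (p - 1 - c))"
      by (subst sum.swap) (simp add: sum_distrib_left mult.commute)
    moreover have "(\<Sum>t<p. int t * ?F (int t) d) = (\<Sum>c=1..<p. d (3 + c) * ?P (p - c))"
    proof -
      have "(\<Sum>t<p. int t * ?F (int t) d) = (\<Sum>t<p. \<Sum>c=1..<p. d (3 + c) * int t ^ (p - c))"
        unfolding sum_distrib_left
      proof (intro sum.cong refl)
        fix t c assume "c \<in> {1..<p}"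
        then have "p - c = Suc (p - 1 - c)" by auto
        then show "int t * (int t ^ (p - 1 - c) * d (3 + c)) = d (3 + c) * int t ^ (p - c)"
          by (simp only: power_Suc) (simp add: mult_ac)
      qed
      also have "\<dots> = (\<Sum>c=1..<p. \<Sum>t<p. d (3 + c) * int t ^ (p - c))" by (rule sum.swap)
      finally show ?thesis by (simp only: sum_distrib_left)
    qed
    ultimately show ?thesis by (simp only: sum_subtractf)
  qed
  \<comment> \<open>Only \<open>c = 0\<close> has exponent \<open>p - 1\<close>; the power sums with
    smaller exponents vanish.\<close>
  have gb: "[(\<Sum>c<p. b (3 + p + c) * ?P (p - 1 - c)) = b (3 + p) * (-1) + 0] (mod int p)"
  proof -
    have "(\<Sum>c<p. b (3 + p + c) * ?P (p - 1 - c))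
       = b (3 + p) * ?P (p - 1) + (\<Sum>c=1..<p. b (3 + p + c) * ?P (p - 1 - c))"
      using p by (subst sum_lessThan_split_first) auto
    moreover have "int p dvd (\<Sum>c=1..<p. b (3 + p + c) * ?P (p - 1 - c))"
      by (rule dvd_sum, rule dvd_mult) (use power_sum_cong_0[OF p(1)] in \<open>auto simp: cong_0_iff\<close>)
    ultimately show ?thesis
      by (simp only: cong_add cong_scalar_left power_sum_cong_minus_1[OF p(1)] cong_0_iff)
  qed
  have fa: "[(\<Sum>c=1..<p. a (3 + c) * ?P (p - 1 - c)) = 0] (mod int p)"
    unfolding cong_0_iff
    by (rule dvd_sum, rule dvd_mult) (use power_sum_cong_0[OF p(1)] in \<open>auto simp: cong_0_iff\<close>)
  \<comment> \<open>The factor \<open>t\<close> has raised the exponents by one, so here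
    \<open>c = 1\<close>, that is coordinate \<open>4\<close>, survives.\<close>
  have fd: "[(\<Sum>c=1..<p. d (3 + c) * ?P (p - c)) = d 4 * (-1) + 0] (mod int p)"
  proof -
    have "(\<Sum>c=1..<p. d (3 + c) * ?P (p - c))
       = d 4 * ?P (p - 1) + (\<Sum>c=2..<p. d (3 + c) * ?P (p - c))"
      using p by (subst sum.atLeast_Suc_lessThan) (auto simp: numeral_2_eq_2)
    moreover have "int p dvd (\<Sum>c=2..<p. d (3 + c) * ?P (p - c))"
      by (rule dvd_sum, rule dvd_mult) (use power_sum_cong_0[OF p(1)] in \<open>auto simp: cong_0_iff\<close>)
    ultimately show ?thesis
      by (simp only: cong_add cong_scalar_left power_sum_cong_minus_1[OF p(1)] cong_0_iff)
  qed
  have "[(b (3 + p) * (-1) + 0) - 0 - (d 4 * (-1) + 0) = -1] (mod int p)"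
    using cong_trans[OF cong_sym[OF cong_diff[OF cong_diff[OF gb fa] fd]]
        cong_trans[OF tot[unfolded eq] power_sum_cong_minus_1[OF p(1)]]] .
  then have 1: "[d 4 - b (3 + p) = -1] (mod int p)" by simp
  \<comment> \<open>The difference is twice the coefficient of \<open>t\<close>.\<close>
  have "[infinite_form p 1 (\<lambda>i. b i + 1 * d i) - infinite_form p (-1) (\<lambda>i. b i + (-1) * d i) = 0 - 0] (mod int p)"
    by (intro cong_diff m)
  then have "[2 * (d 4 - b (3 + p)) = 2 * 0] (mod int p)"
    by (simp add: infinite_form_def algebra_simps)
  then have "[d 4 - b (3 + p) = 0] (mod int p)" using cong_mult_lcancel[OF cop] by blast
  with 1 have "[0 = -1] (mod int p)" by (metis cong_sym cong_trans)
  then show False using nd by (simp add: cong_iff_dvd_diff)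
qed

section \<open>The group as a set of reduced vectors\<close>

abbreviation zpn :: "nat \<Rightarrow> (nat \<Rightarrow> int) monoid" where
  "zpn p \<equiv> product_group {..<2 * p + 3} (\<lambda>_. integer_mod_group p)"

definition reduce_mod :: "nat \<Rightarrow> (nat \<Rightarrow> int) \<Rightarrow> nat \<Rightarrow> int" where
  "reduce_mod p v = (\<lambda>i\<in>{..<2 * p + 3}. v i mod int p)"

lemma group_zpn: "group (zpn p)"
  by simp

lemma carrier_zpn: "p > 0 \<Longrightarrow> carrier (zpn p) = {..<2 * p + 3} \<rightarrow>\<^sub>E {0..<int p}"
  by (simp add: carrier_integer_mod_group)

lemma reduce_mod_in_carrier: "p > 0 \<Longrightarrow> reduce_mod p v \<in> carrier (zpn p)"
  unfolding carrier_zpn by (auto simp: reduce_mod_def)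

lemma vcong_reduce_mod: "vcong p (reduce_mod p v) v"
  by (simp add: vcong_def reduce_mod_def cong_def)

lemma vcong_mult: "vcong p (v \<otimes>\<^bsub>zpn p\<^esub> w) (\<lambda>i. v i + w i)"
  by (simp add: vcong_def cong_def)

lemma vcong_refl: "vcong p v v"
  by (simp add: vcong_def)

lemma vcong_diff:
  assumes "vcong p u u'" "vcong p v v'" shows "vcong p (\<lambda>i. u i - v i) (\<lambda>i. u' i - v' i)"
  using assms unfolding vcong_def by (blast intro: cong_diff)

lemma vcong_inv:
  assumes "w \<in> carrier (zpn p)" shows "vcong p (inv\<^bsub>zpn p\<^esub> w) (\<lambda>i. - w i)"
proof -
  have "w i \<in> carrier (integer_mod_group p)" if "i < 2 * p + 3" for i
    using assms that by (auto simp: PiE_iff)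
  then show ?thesis
    using assms by (simp add: vcong_def cong_def)
qed

lemma vcong_mult_inv:
  assumes "w \<in> carrier (zpn p)" shows "vcong p (v \<otimes>\<^bsub>zpn p\<^esub> inv\<^bsub>zpn p\<^esub> w) (\<lambda>i. v i - w i)"
proof (rule vcong_trans[OF vcong_mult])
  show "vcong p (\<lambda>i. v i + (inv\<^bsub>zpn p\<^esub> w) i) (\<lambda>i. v i - w i)"
    using vcong_inv[OF assms] unfolding vcong_def
    by (metis cong_add_lcancel uminus_add_conv_diff add.commute)
qed

lemma carrier_zpn_eqI:
  assumes "p > 0" "v \<in> carrier (zpn p)" "w \<in> carrier (zpn p)" "vcong p v w"
  shows "v = w"
proof (rule PiE_ext)
  show "v \<in> {..<2 * p + 3} \<rightarrow>\<^sub>E {0..<int p}" "w \<in> {..<2 * p + 3} \<rightarrow>\<^sub>E {0..<int p}"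
    using assms carrier_zpn by auto
  then show "v i = w i" if "i \<in> {..<2 * p + 3}" for i
    using that assms(4) unfolding vcong_def PiE_iff
    by (metis atLeastLessThan_iff cong_def lessThan_iff mod_pos_pos_trivial)
qed

text \<open>The twist reads only coordinates \<open>0, 1, 2\<close> and vanishes on them. The image
  thus determines these coordinates, hence the twist, hence the vector; finiteness gives
  surjectivity.\<close>

lemma shift_twist_bij:
  assumes "p > 0"
  shows "bij_betw (\<lambda>v. reduce_mod p (\<lambda>i. v i + twist p v i)) (carrier (zpn p)) (carrier (zpn p))"
proof -
  let ?f = "\<lambda>v. reduce_mod p (\<lambda>i. v i + twist p v i)"
  have fin: "finite (carrier (zpn p))" unfolding carrier_zpn[OF assms] by (intro finite_PiE) auto
  have sub: "?f ` carrier (zpn p) \<subseteq> carrier (zpn p)" using reduce_mod_in_carrier[OF assms] by blast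
  have inj: "inj_on ?f (carrier (zpn p))"
  proof (rule inj_onI)
    fix v w assume vw: "v \<in> carrier (zpn p)" "w \<in> carrier (zpn p)" and eq: "?f v = ?f w"
    have vc: "vcong p (\<lambda>i. v i + twist p v i) (\<lambda>i. w i + twist p w i)"
      using vcong_reduce_mod[of p "\<lambda>i. v i + twist p v i"] vcong_reduce_mod[of p "\<lambda>i. w i + twist p w i"]
      unfolding eq by (meson vcong_sym vcong_trans)
    have low: "v i = w i" if i: "i < 3" for i
    proof -
      have "twist p v i = 0" "twist p w i = 0" using i by (simp_all add: twist_def)
      moreover have "[v i + twist p v i = w i + twist p w i] (mod int p)"
        using vc i by (simp add: vcong_def)
      ultimately have "[v i = w i] (mod int p)" by simp
      moreover have "v i \<in> {0..<int p}" "w i \<in> {0..<int p}"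
        using vw i unfolding carrier_zpn[OF assms] by (auto simp: PiE_iff)
      ultimately show ?thesis by (simp add: cong_def)
    qed
    have "twist p v = twist p w"
      by (rule ext) (simp add: twist_def low)
    then have "vcong p v w"
      using vc by (simp add: vcong_def cong_add_rcancel)
    then show "v = w" using carrier_zpn_eqI assms vw by blast
  qed
  show ?thesis using endo_inj_surj[OF fin sub inj] inj by (simp add: bij_betw_def)
qed

section \<open>Automorphisms carrying \<open>S\<close> to \<open>T\<close>\<close>

lemma lies_over_diff:
  assumes "lies_over p u x y z" "lies_over p v x' y' z'"
  shows "lies_over p (\<lambda>i. u i - v i) (x - x') (y - y') (z - z')"
  using assms unfolding lies_over_def by (blast intro: cong_diff)

lemma lies_over_add:
  assumes "lies_over p u x y z" "lies_over p v x' y' z'"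
  shows "lies_over p (\<lambda>i. u i + v i) (x + x') (y + y') (z + z')"
  using assms unfolding lies_over_def by (blast intro: cong_add)

lemma lies_over_scale:
  assumes "lies_over p u x y z"
  shows "lies_over p (\<lambda>i. r * u i) (r * x) (r * y) (r * z)"
  using assms unfolding lies_over_def by (blast intro: cong_scalar_left)

text \<open>The fibres of \<open>S\<close> are kernels or all of \<open>W\<close>, so they contain
  the zero of \<open>W\<close>.\<close>

lemma connection_0_truncate:
  assumes "connection p 0 u" shows "connection p 0 (\<lambda>i. if i < 3 then u i else 0)"
proof -
  have "affine_form p s t (\<lambda>i. if i < 3 then u i else 0) = 0" for s t
    by (simp add: affine_form_def)
  moreover have "infinite_form p t (\<lambda>i. if i < 3 then u i else 0) = 0" for t
    by (simp add: infinite_form_def)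
  moreover have "lies_over p (\<lambda>i. if i < 3 then u i else 0) x y z \<longleftrightarrow> lies_over p u x y z" for x y z
    by (simp add: lies_over_def)
  ultimately show ?thesis using assms unfolding connection_def mult_zero_left by (metis cong_refl)
qed

lemma connection_1_lies_over_1_exists:
  assumes "p > 0"
  shows "\<exists>v. lies_over p v 1 s t \<and> connection p 1 v"
proof -
  \<comment> \<open>Coordinate \<open>3 + p\<close> has weight \<open>t ^ (p - 1)\<close> in
    \<open>affine_form\<close>, so the entry \<open>s\<close> there gives the required
    value.\<close>
  let ?v = "\<lambda>i. if i = 0 then 1 else if i = 1 then s else if i = 2 then t else if i = 3 + p then s else (0::int)"
  have "(\<Sum>c<p. t ^ (p - 1 - c) * ?v (3 + p + c)) = t ^ (p - 1) * s"
    using assms by (subst sum_lessThan_split_first) auto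
  moreover have "(\<Sum>c=1..<p. t ^ (p - 1 - c) * ?v (3 + c)) = 0"
    by (rule sum.neutral) auto
  ultimately have "affine_form p s t ?v = 1 * 1 * s * t ^ (p - 1)" unfolding affine_form_def by simp
  then have "[affine_form p s t ?v = 1 * 1 * s * t ^ (p - 1)] (mod int p)" by simp
  moreover have "lies_over p ?v 1 (1 * s) (1 * t)" by (simp add: lies_over_def)
  ultimately have "connection p 1 ?v" unfolding connection_def by blast
  moreover have "lies_over p ?v 1 s t" by (simp add: lies_over_def)
  ultimately show ?thesis by blast
qed

lemma connection_lies_over_0_1_exists: "\<exists>v. lies_over p v 0 1 t \<and> connection p k v"
proof -
  let ?v = "\<lambda>i. if i = 1 then 1 else if i = 2 then t else (0::int)"
  have "[infinite_form p t ?v = 0] (mod int p)" by (simp add: infinite_form_def)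
  moreover have "lies_over p ?v 0 1 (1 * t)" by (simp add: lies_over_def)
  ultimately have "connection p k ?v" unfolding connection_def by blast
  moreover have "lies_over p ?v 0 1 t" by (simp add: lies_over_def)
  ultimately show ?thesis by blast
qed

lemma no_automorphism:
  assumes p: "prime p" "p > 3"
    and hom: "\<sigma> \<in> hom (zpn p) (zpn p)"
    and bij: "bij_betw \<sigma> (carrier (zpn p)) (carrier (zpn p))"
    and im: "\<sigma> ` {v \<in> carrier (zpn p). connection p 0 v} = {v \<in> carrier (zpn p). connection p 1 v}"
  shows False
proof -
  let ?G = "zpn p"
  interpret Z: group ?G by (rule group_zpn)
  interpret group_hom ?G ?G \<sigma> by unfold_locales (rule hom)
  have p0: "p > 0" "p > 1" using p(2) by auto
  have \<sigma>_mult_inv: "\<sigma> (x \<otimes>\<^bsub>?G\<^esub> inv\<^bsub>?G\<^esub> y) = \<sigma> x \<otimes>\<^bsub>?G\<^esub> inv\<^bsub>?G\<^esub> (\<sigma> y)"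
    if "x \<in> carrier ?G" "y \<in> carrier ?G" for x y
    using hom_mult[OF that(1) Z.inv_closed[OF that(2)]]  unfolding hom_inv[OF that(2)] .
  have to_T: "connection p 1 (\<sigma> v)" if "v \<in> carrier ?G" "connection p 0 v" for v
    using im that by blast
  have connection_W: "connection p k v" if "lies_over p v 0 0 0" for k v using that by (simp add: connection_def)
  define W where "W = {v \<in> carrier ?G. lies_over p v 0 0 0}"
  \<comment> \<open>Both \<open>v\<close> and its double lie in \<open>S\<close>, so
    \<open>\<sigma> v\<close> and its double lie in \<open>T\<close>, and
    \<open>connection_double\<close> applies.\<close>
  have \<sigma>W: "\<sigma> v \<in> W" if "v \<in> W" for v
  proof -
    have v: "v \<in> carrier ?G" "lies_over p v 0 0 0" using that by (auto simp: W_def)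
    have "lies_over p (v \<otimes>\<^bsub>?G\<^esub> v) 0 0 0"
      using lies_over_add[OF v(2) v(2)] lies_over_vcong[OF vcong_mult] by (metis add_0)
    then have "connection p 1 (\<sigma> (v \<otimes>\<^bsub>?G\<^esub> v))" using to_T v(1) connection_W Z.m_closed by blast
    then have "connection p 1 (\<sigma> v \<otimes>\<^bsub>?G\<^esub> \<sigma> v)" using v(1) by (simp only: hom_mult)
    then have "connection p 1 (\<lambda>i. \<sigma> v i + \<sigma> v i)" using connection_vcong vcong_mult p0 by blast
    moreover have "connection p 1 (\<sigma> v)" using to_T v connection_W by blast
    ultimately have "lies_over p (\<sigma> v) 0 0 0" using connection_double p(2) by blast
    then show ?thesis using v(1) hom_closed by (simp only: W_def mem_Collect_eq)
  qed
  have finW: "finite W" unfolding W_def carrier_zpn[OF p0(1)]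
    by (intro finite_subset[OF _ finite_PiE[of "{..<2 * p + 3}" "\<lambda>_. {0..<int p}"]]) auto
  have inj: "inj_on \<sigma> (carrier ?G)" using bij by (simp only: bij_betw_def)
  have Wc: "W \<subseteq> carrier ?G" unfolding W_def by blast
  have "\<sigma> ` W = W"
    by (rule endo_inj_surj[OF finW]) (use \<sigma>W inj Wc inj_on_subset in blast)+
  then have W\<sigma>: "v \<in> W" if v: "v \<in> carrier ?G" "\<sigma> v \<in> W" for v
  proof -
    obtain w where w: "w \<in> W" "\<sigma> v = \<sigma> w" using v(2) \<open>\<sigma> ` W = W\<close> by blast
    then have "v = w" using inj_onD[OF inj w(2) v(1)] Wc by blast
    then show ?thesis using w(1) by blast
  qed
  define E where "E = {v \<in> carrier ?G. \<forall>i. 3 \<le> i \<and> i < 2 * p + 3 \<longrightarrow> [v i = 0] (mod int p)}"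
  have Ec: "a \<in> carrier ?G" if "a \<in> E" for a using that by (simp only: E_def mem_Collect_eq)
  \<comment> \<open>\<open>E\<close> is the copy of \<open>U\<close>. Membership in
    \<open>\<sigma> E\<close> is made a predicate on integer vectors up to congruence, so that
    linear combinations need no reduction.\<close>
  define L where "L u \<longleftrightarrow> (\<exists>a\<in>E. vcong p (\<sigma> a) u)" for u
  have L_\<sigma>: "L (\<sigma> a)" if "a \<in> E" for a
    using that vcong_refl unfolding L_def by blast
  have L_diff: "L (\<lambda>i. u i - v i)" if "L u" "L v" for u v
  proof -
    obtain a b where a: "a \<in> E" "vcong p (\<sigma> a) u" and b: "b \<in> E" "vcong p (\<sigma> b) v"
      using \<open>L u\<close> \<open>L v\<close> unfolding L_def by blast
    let ?c = "a \<otimes>\<^bsub>?G\<^esub> inv\<^bsub>?G\<^esub> b"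
    have "[?c i = 0] (mod int p)" if "3 \<le> i \<and> i < 2 * p + 3" for i
    proof -
      have "[?c i = a i - b i] (mod int p)"
        using vcong_mult_inv[OF Ec[OF b(1)], of a] that unfolding vcong_def by blast
      also have "[a i - b i = 0 - 0] (mod int p)"
        using a(1) b(1) that unfolding E_def by (intro cong_diff) blast+
      finally show ?thesis by simp
    qed
    then have "?c \<in> E"
      using Ec[OF a(1)] Ec[OF b(1)] Z.m_closed Z.inv_closed unfolding E_def by blast
    moreover have "vcong p (\<sigma> ?c) (\<lambda>i. \<sigma> a i - \<sigma> b i)"
      unfolding \<sigma>_mult_inv[OF Ec[OF a(1)] Ec[OF b(1)]]
      by (rule vcong_mult_inv[OF hom_closed[OF Ec[OF b(1)]]])
    moreover have "vcong p (\<lambda>i. \<sigma> a i - \<sigma> b i) (\<lambda>i. u i - v i)"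
      by (rule vcong_diff[OF a(2) b(2)])
    ultimately show ?thesis unfolding L_def using vcong_trans by blast
  qed
  have L_0: "L (\<lambda>i. 0)" if "L u" for u using L_diff[OF that that] by simp
  have L_add: "L (\<lambda>i. u i + v i)" if "L u" "L v" for u v
    using L_diff[OF that(1) L_diff[OF L_0[OF that(2)] that(2)]] by simp
  have L_nat: "L (\<lambda>i. int n * u i)" if "L u" for u n
  proof (induction n)
    case 0 then show ?case using L_0[OF that] by simp
  next
    case (Suc n) then show ?case using L_add[OF that Suc] by (simp add: algebra_simps)
  qed
  have L_scale: "L (\<lambda>i. r * u i)" if "L u" for u r
  proof (cases r rule: int_cases2)
    case (nonneg n) then show ?thesis using L_nat[OF that] by simp
  next
    case (nonpos n) then show ?thesis using L_diff[OF L_0[OF that] L_nat[OF that, of n]] by simp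
  qed
  \<comment> \<open>\<open>E\<close> meets \<open>W\<close> only in the identity and
    \<open>\<sigma>\<close> preserves \<open>W\<close>, so \<open>\<sigma> E\<close> also meets
    \<open>W\<close> trivially.\<close>
  have L_zero: "vcong p u (\<lambda>i. 0)" if u: "L u" "lies_over p u 0 0 0" for u
  proof -
    obtain a where a: "a \<in> E" "vcong p (\<sigma> a) u" using u(1) unfolding L_def by blast
    then have "\<sigma> a \<in> W" using u(2) lies_over_vcong[OF a(2)] hom_closed[OF Ec[OF a(1)]]
      unfolding W_def by blast
    then have aW: "a \<in> W" using W\<sigma> Ec[OF a(1)] by blast
    have "[a i = 0] (mod int p)" if i: "i < 2 * p + 3" for i
    proof (cases "i < 3")
      case True
      then have "i = 0 \<or> i = 1 \<or> i = 2" by auto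
      then show ?thesis using aW unfolding W_def lies_over_def by blast
    next
      case False
      then show ?thesis using a(1) i unfolding E_def by force
    qed
    then have "vcong p a \<one>\<^bsub>?G\<^esub>" by (simp add: vcong_def)
    then have "a = \<one>\<^bsub>?G\<^esub>" using carrier_zpn_eqI[OF p0(1) Ec[OF a(1)] Z.one_closed] by blast
    then have "\<sigma> a = \<one>\<^bsub>?G\<^esub>" using hom_one by blast
    then show ?thesis using a(2) by (simp add: vcong_def cong_sym_eq)
  qed
  have L_unique: "vcong p u v" if "L u" "L v" "lies_over p u x y z" "lies_over p v x y z" for u v x y z
  proof -
    have "lies_over p (\<lambda>i. u i - v i) 0 0 0" using lies_over_diff[OF that(3,4)] by simp
    then have "vcong p (\<lambda>i. u i - v i) (\<lambda>i. 0)" using L_zero L_diff that by blast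
    then show ?thesis by (simp add: vcong_def cong_diff_iff_cong_0)
  qed
  \<comment> \<open>Write the point of \<open>T\<close> as \<open>\<sigma> u\<close> with
    \<open>u\<close> in \<open>S\<close>. Truncating \<open>u\<close> to \<open>E\<close> stays in
    \<open>S\<close> and changes \<open>\<sigma> u\<close> only by an element of
    \<open>W\<close>.\<close>
  have ex: "\<exists>u. L u \<and> lies_over p u x y z \<and> connection p 1 u" if "lies_over p v x y z" "connection p 1 v" for v x y z
  proof -
    have "connection p 1 (reduce_mod p v)" using connection_vcong[OF vcong_sym[OF vcong_reduce_mod] p0(2)] that(2) by blast
    then have "reduce_mod p v \<in> \<sigma> ` {v \<in> carrier ?G. connection p 0 v}"
      unfolding im mem_Collect_eq by (intro conjI reduce_mod_in_carrier p0)
    then obtain u where "reduce_mod p v = \<sigma> u" "u \<in> {v \<in> carrier ?G. connection p 0 v}" by (rule imageE)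
    then have u: "u \<in> carrier ?G" "connection p 0 u" "\<sigma> u = reduce_mod p v" by (simp_all only: mem_Collect_eq)
    let ?a = "reduce_mod p (\<lambda>i. if i < 3 then u i else 0)"
    have aE: "?a \<in> E"
      using reduce_mod_in_carrier[OF p0(1)] unfolding E_def by (simp add: reduce_mod_def)
    note ac = Ec[OF aE]
    have "connection p 0 ?a"
      using connection_vcong[OF vcong_sym[OF vcong_reduce_mod] p0(2)] connection_0_truncate[OF u(2)] by blast
    then have T: "connection p 1 (\<sigma> ?a)" using to_T ac by blast
    have ov: "lies_over p ?a (u 0) (u 1) (u 2)"
      unfolding lies_over_vcong[OF vcong_reduce_mod] by (simp add: lies_over_def)
    have "lies_over p (\<lambda>i. u i - ?a i) (u 0 - u 0) (u 1 - u 1) (u 2 - u 2)"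
      by (rule lies_over_diff[OF _ ov]) (simp add: lies_over_def)
    then have "lies_over p (u \<otimes>\<^bsub>?G\<^esub> inv\<^bsub>?G\<^esub> ?a) 0 0 0"
      unfolding lies_over_vcong[OF vcong_mult_inv[OF ac]] by simp
    then have "u \<otimes>\<^bsub>?G\<^esub> inv\<^bsub>?G\<^esub> ?a \<in> W"
      using u(1) ac Z.m_closed Z.inv_closed unfolding W_def by blast
    then have "\<sigma> (u \<otimes>\<^bsub>?G\<^esub> inv\<^bsub>?G\<^esub> ?a) \<in> W" by (rule \<sigma>W)
    then have "\<sigma> u \<otimes>\<^bsub>?G\<^esub> inv\<^bsub>?G\<^esub> \<sigma> ?a \<in> W"
      unfolding \<sigma>_mult_inv[OF u(1) ac] .
    then have 0: "lies_over p (\<lambda>i. reduce_mod p v i - \<sigma> ?a i) 0 0 0"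
      unfolding W_def u(3) mem_Collect_eq lies_over_vcong[OF vcong_mult_inv[OF hom_closed[OF ac]]] by blast
    have "lies_over p (reduce_mod p v) x y z" unfolding lies_over_vcong[OF vcong_reduce_mod] by (rule that(1))
    from lies_over_diff[OF this 0] have "lies_over p (\<sigma> ?a) x y z" by simp
    then show ?thesis using L_\<sigma>[OF aE] T by blast
  qed
  have ex1: "\<exists>u. L u \<and> lies_over p u 1 s t \<and> [affine_form p s t u = s * t ^ (p - 1)] (mod int p)" for s t
    using connection_1_lies_over_1_exists[OF p0(1), of s t] ex connection_lies_over_1[OF p(2), of 1]
    by (metis mult_1)
  have ex2: "\<exists>u. L u \<and> lies_over p u 0 1 t \<and> [infinite_form p t u = 0] (mod int p)" for t
    using connection_lies_over_0_1_exists[of p t 1] ex connection_lies_over_0_1[OF p(2)] by blast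
  obtain a where a: "L a" "lies_over p a 1 0 0" using ex1 by blast
  obtain b where b: "L b" "lies_over p b 0 1 0" using ex2 by blast
  \<comment> \<open>\<open>(0, 0, 1)\<close> is not a direction, so the point over it comes from a
    difference of two directions.\<close>
  obtain c where c: "L c" "lies_over p c 0 1 1" using ex2 by blast
  define d where "d = (\<lambda>i. c i - b i)"
  have d: "L d" "lies_over p d 0 0 1"
    using L_diff[OF c(1) b(1)] lies_over_diff[OF c(2) b(2)] unfolding d_def by simp_all
  show False
  proof (rule no_linear_interpolation[OF p, of a b d])
    fix s t
    have L: "L (\<lambda>i. a i + s * b i + t * d i)"
      by (intro L_add L_scale a b d)
    have "lies_over p (\<lambda>i. a i + s * b i + t * d i) 1 s t"
      using lies_over_add[OF lies_over_add[OF a(2) lies_over_scale[OF b(2), of s]] lies_over_scale[OF d(2), of t]] by simp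
    with ex1[of s t] L L_unique obtain u where
      "vcong p (\<lambda>i. a i + s * b i + t * d i) u" "[affine_form p s t u = s * t ^ (p - 1)] (mod int p)" by blast
    then show "[affine_form p s t (\<lambda>i. a i + s * b i + t * d i) = s * t ^ (p - 1)] (mod int p)"
      using affine_form_cong[OF _ cong_refl cong_refl] cong_trans by blast
  next
    fix t
    have L: "L (\<lambda>i. b i + t * d i)"
      by (intro L_add L_scale b d)
    have "lies_over p (\<lambda>i. b i + t * d i) 0 1 t"
      using lies_over_add[OF b(2) lies_over_scale[OF d(2), of t]] by simp
    with ex2[of t] L L_unique obtain u where
      "vcong p (\<lambda>i. b i + t * d i) u" "[infinite_form p t u = 0] (mod int p)" by blast
    then show "[infinite_form p t (\<lambda>i. b i + t * d i) = 0] (mod int p)"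
      using infinite_form_cong[OF _ cong_refl p0(2)] cong_trans by blast
  qed
qed

section \<open>An undirected Cayley graph without the CI property\<close>

theorem theorem2:
  fixes p :: nat
  assumes "prime p" and "p > 3"
  defines "G \<equiv> product_group {..<2 * p + 3} (\<lambda>_. integer_mod_group p)"
  shows "\<exists>S \<subseteq> carrier G. set_inv\<^bsub>G\<^esub> S = S \<and> \<not> CI_graph G S"
proof -
  interpret group G unfolding G_def by (rule group_zpn)
  have p0: "p > 0" "p > 1" using assms(2) by auto
  define S where "S = {v \<in> carrier G. connection p 0 v}"
  define T where "T = {v \<in> carrier G. connection p 1 v}"
  have invS: "inv\<^bsub>G\<^esub> v \<in> S" if "v \<in> S" for v
  proof -
    have v: "v \<in> carrier G" "connection p 0 v" using that by (auto simp: S_def)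
    have "connection p 0 (inv\<^bsub>G\<^esub> v)"
      using connection_vcong[OF vcong_sym[OF vcong_inv] p0(2) connection_0_uminus[OF v(2)]] v(1)
      unfolding G_def by blast
    then show ?thesis using v(1) inv_closed unfolding S_def by blast
  qed
  have sym: "set_inv\<^bsub>G\<^esub> S = S"
  proof
    show "set_inv\<^bsub>G\<^esub> S \<subseteq> S" using invS unfolding SET_INV_def by blast
    show "S \<subseteq> set_inv\<^bsub>G\<^esub> S"
    proof
      fix v assume v: "v \<in> S"
      then have "v = inv\<^bsub>G\<^esub> (inv\<^bsub>G\<^esub> v)" by (metis S_def inv_inv mem_Collect_eq)
      then show "v \<in> set_inv\<^bsub>G\<^esub> S" using invS[OF v] unfolding SET_INV_def by blast
    qed
  qed
  let ?f = "\<lambda>v. reduce_mod p (\<lambda>i. v i + twist p v i)"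
  have adj: "g \<otimes>\<^bsub>G\<^esub> inv\<^bsub>G\<^esub> h \<in> S \<longleftrightarrow> ?f g \<otimes>\<^bsub>G\<^esub> inv\<^bsub>G\<^esub> ?f h \<in> T"
    if gh: "g \<in> carrier G" "h \<in> carrier G" for g h
  proof -
    have f: "?f v \<in> carrier G" for v unfolding G_def by (rule reduce_mod_in_carrier[OF p0(1)])
    have c: "connection p k u \<longleftrightarrow> connection p k v" if "vcong p u v" for k u v
      using connection_vcong[OF that p0(2)] connection_vcong[OF vcong_sym[OF that] p0(2)] by blast
    have "connection p 0 (g \<otimes>\<^bsub>G\<^esub> inv\<^bsub>G\<^esub> h) \<longleftrightarrow> connection p 0 (\<lambda>i. g i - h i)"
      using c vcong_mult_inv gh unfolding G_def by blast
    also have "\<dots> \<longleftrightarrow> connection p 1 (\<lambda>i. (g i + twist p g i) - (h i + twist p h i))"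
      using connection_shift_twist[OF assms(1)] by blast
    also have "\<dots> \<longleftrightarrow> connection p 1 (\<lambda>i. ?f g i - ?f h i)"
      by (rule c) (intro vcong_diff vcong_sym[OF vcong_reduce_mod])
    also have "\<dots> \<longleftrightarrow> connection p 1 (?f g \<otimes>\<^bsub>G\<^esub> inv\<^bsub>G\<^esub> ?f h)"
      using c vcong_mult_inv f unfolding G_def by blast
    finally show ?thesis unfolding S_def T_def using gh f m_closed inv_closed by blast
  qed
  have iso: "digraph_iso (with_proj (Cayley_graph G S)) (with_proj (Cayley_graph G T))"
    unfolding digraph_iso_Cayley_graph_iff using adj shift_twist_bij[OF p0(1)] unfolding G_def by blast
  have "\<not> CI_graph G S"
  proof
    assume "CI_graph G S"
    moreover have "T \<subseteq> carrier G" unfolding T_def by blast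
    ultimately obtain \<sigma> where \<sigma>: "\<sigma> \<in> auto G" "\<sigma> ` S = T"
      using iso unfolding CI_graph_def by blast
    then have "\<sigma> \<in> hom G G" "bij_betw \<sigma> (carrier G) (carrier G)"
      by (auto simp: auto_def Bij_def)
    then show False
      using no_automorphism[OF assms(1,2)] \<sigma>(2) unfolding S_def T_def G_def by blast
  qed
  moreover have "S \<subseteq> carrier G" unfolding S_def by blast
  ultimately show ?thesis using sym by blast
qed

end
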